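(* Let $(X,d_X)$ be a metric space and let $L\geq K\geq 1$ be natural numbers. Then the hypergeometric map $\mathrm{hg}[K]\colon\mathcal{M}[L](X)\to\mathcal{D}(\mathcal{M}[K](X))$ is short and in fact an isometry: for all $\upsilon,\upsilon'\in\mathcal{M}[L](X)$, $$d_{\mathcal{D}(\mathcal{M}[K](X))}\big(\mathrm{hg}[K](\upsilon),\mathrm{hg}[K](\upsilon')\big)=d_{\mathcal{M}[L](X)}(\upsilon,\upsilon').$$
   Context: For a set $X$, $\mathcal{M}[K](X)$ is the set of multisets of size $K$ over $X$: functions $\varphi\colon X\to\mathbb{N}$ with finite support and $\sum_{x}\varphi(x)=K$. $\mathcal{D}(X)$ is the set of finitely supported probability distributions on $X$. Kantorovich metric on distributions: for a metric space $(X,d_X)$ and $\omega,\omega'\in\mathcal{D}(X)$, $d_{\mathcal{D}(X)}(\omega,\omega')=\min_{\tau}\sum_{x,x'}\tau(x,x')\,d_X(x,x')$, where $\tau$ ranges over the $\tau\in\mathcal{D}(X\times X)$ with first marginal $\omega$ and second marginal $\omega'$. Kantorovich metric on multisets: for $K\geq 1$ and $\varphi,\varphi'\in\mathcal{M}[K](X)$, $d_{\mathcal{M}[K](X)}(\varphi,\varphi')=\min_{\tau}\frac1K\sum_{x,x'}\tau(x,x')\,d_X(x,x')$, where $\tau$ ranges over the multisets $\tau\in\mathcal{M}[K](X\times X)$ with marginals $\sum_{x'}\tau(x,x')=\varphi(x)$ and $\sum_{x}\tau(x,x')=\varphi'(x')$. The space $\mathcal{D}(\mathcal{M}[K](X))$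 carries the Kantorovich metric over the metric space $\mathcal{M}[K](X)$. A map $f$ between metric spaces is short if $d(f(x),f(x'))\leq d(x,x')$ for all $x,x'$, and an isometry if equality holds for all $x,x'$. Hypergeometric: for $\upsilon\in\mathcal{M}[L](X)$ and $\varphi\in\mathcal{M}[K](X)$, $\mathrm{hg}[K](\upsilon)(\varphi)=\Big(\prod_{x\in X}\binom{\upsilon(x)}{\varphi(x)}\Big)\Big/\binom{L}{K}$ if $\varphi(x)\leq\upsilon(x)$ for all $x$, and $0$ otherwise. *)

theory Defs
  imports "HOL-Probability.Probability"
begin

definition dists :: "'a set \<Rightarrow> 'a pmf set" where
  "dists X = {\<omega>. finite (set_pmf \<omega>) \<and> set_pmf \<omega> \<subseteq> X}"

text \<open>
  In both Kantorovich distances below, the operator \<open>LEAST\<close> on the reals denotes the minimum of the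
  set of transport costs.
\<close>

definition kantorovich_dist :: "'a set \<Rightarrow> ('a \<Rightarrow> 'a \<Rightarrow> real) \<Rightarrow> 'a pmf \<Rightarrow> 'a pmf \<Rightarrow> real" where
  "kantorovich_dist X d \<omega> \<omega>' =
     (LEAST c. \<exists>\<tau> \<in> dists (X \<times> X). map_pmf fst \<tau> = \<omega> \<and> map_pmf snd \<tau> = \<omega>' \<and>
        c = (\<Sum>(x, x') \<in> set_pmf \<tau>. pmf \<tau> (x, x') * d x x'))"

definition kantorovich_mset ::
    "nat \<Rightarrow> 'a set \<Rightarrow> ('a \<Rightarrow> 'a \<Rightarrow> real) \<Rightarrow> 'a multiset \<Rightarrow> 'a multiset \<Rightarrow> real" where
  "kantorovich_mset K X d \<phi> \<phi>' =
     (LEAST c. \<exists>\<tau> \<in> multisets_of_size (X \<times> X) K. image_mset fst \<tau> = \<phi> \<and> image_mset snd \<tau> = \<phi>' \<and>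
        c = 1 / real K * (\<Sum>(x, x') \<in> set_mset \<tau>. real (count \<tau> (x, x')) * d x x'))"

definition short_map ::
    "'a set \<Rightarrow> ('a \<Rightarrow> 'a \<Rightarrow> real) \<Rightarrow> 'b set \<Rightarrow> ('b \<Rightarrow> 'b \<Rightarrow> real) \<Rightarrow> ('a \<Rightarrow> 'b) \<Rightarrow> bool" where
  "short_map A dA B dB f \<longleftrightarrow>
     f \<in> A \<rightarrow> B \<and> (\<forall>x\<in>A. \<forall>x'\<in>A. dB (f x) (f x') \<le> dA x x')"

definition isometry_map ::
    "'a set \<Rightarrow> ('a \<Rightarrow> 'a \<Rightarrow> real) \<Rightarrow> 'b set \<Rightarrow> ('b \<Rightarrow> 'b \<Rightarrow> real) \<Rightarrow> ('a \<Rightarrow> 'b) \<Rightarrow> bool" where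
  "isometry_map A dA B dB f \<longleftrightarrow>
     f \<in> A \<rightarrow> B \<and> (\<forall>x\<in>A. \<forall>x'\<in>A. dB (f x) (f x') = dA x x')"

text \<open>
  The product over all points is taken over the finite support of \<open>\<upsilon>\<close> only: as \<open>\<phi>\<close> is contained
  in \<open>\<upsilon>\<close>, all other factors are \<open>0 choose 0 = 1\<close> (while \<open>prod\<close> over an infinite set would
  be 1 by convention).
\<close>

definition hg_weight :: "nat \<Rightarrow> 'a multiset \<Rightarrow> 'a multiset \<Rightarrow> real" where
  "hg_weight K \<upsilon> \<phi> =
     (if size \<phi> = K \<and> \<phi> \<subseteq># \<upsilon>
      then real (\<Prod>x\<in>set_mset \<upsilon>. count \<upsilon> x choose count \<phi> x) / real (size \<upsilon> choose K)
      else 0)"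

text \<open>
  \<open>embed_pmf\<close> is unspecified on functions that are not probability mass functions; the lemma
  \<open>pmf_hg\<close> below shows that for \<open>K \<le> size \<upsilon>\<close> the weights are genuine point probabilities.
\<close>

definition hg :: "nat \<Rightarrow> 'a multiset \<Rightarrow> 'a multiset pmf" where
  "hg K \<upsilon> = embed_pmf (hg_weight K \<upsilon>)"

lemma finite_submsets: "finite {\<phi>. \<phi> \<subseteq># (\<upsilon> :: 'a multiset)}"
proof (induction \<upsilon>)
  case (add a \<upsilon>)
  have "{\<phi>. \<phi> \<subseteq># add_mset a \<upsilon>} \<subseteq> {\<phi>. \<phi> \<subseteq># \<upsilon>} \<union> add_mset a ` {\<phi>. \<phi> \<subseteq># \<upsilon>}"
  proof
    fix \<phi> assume "\<phi> \<in> {\<phi>. \<phi> \<subseteq># add_mset a \<upsilon>}"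
    then have s: "\<phi> \<subseteq># add_mset a \<upsilon>" by simp
    show "\<phi> \<in> {\<phi>. \<phi> \<subseteq># \<upsilon>} \<union> add_mset a ` {\<phi>. \<phi> \<subseteq># \<upsilon>}"
    proof (cases "a \<in># \<phi>")
      case True
      then obtain \<psi> where "\<phi> = add_mset a \<psi>" by (metis mset_add)
      with s show ?thesis by auto
    next
      case False
      with s have "\<phi> \<subseteq># \<upsilon>"
        by (metis Diff_eq_empty_iff_mset add_mset_diff_bothsides diff_single_trivial subset_eq_diff_conv
            add_mset_add_single)
      then show ?thesis by simp
    qed
  qed
  with add show ?case by (meson finite_Un finite_imageI finite_subset)
qed simp

lemma vandermonde_mset:
  "(\<Sum>\<phi> | \<phi> \<subseteq># \<upsilon> \<and> size \<phi> = K. \<Prod>x\<in>set_mset \<upsilon>. count \<upsilon> x choose count \<phi> x)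
     = size \<upsilon> choose K"
proof (induction \<upsilon> arbitrary: K)
  case empty
  have "{\<phi>. \<phi> = {#} \<and> size \<phi> = K} = (if K = 0 then {{#} :: 'a multiset} else {})" by auto
  then show ?case by simp
next
  case (add a \<upsilon>)
  define W where "W = (\<lambda>\<upsilon> \<phi> :: 'a multiset. \<Prod>x\<in>set_mset \<upsilon>. count \<upsilon> x choose count \<phi> x)"
  define S where "S = (\<lambda>(\<upsilon> :: 'a multiset) K. {\<phi>. \<phi> \<subseteq># \<upsilon> \<and> size \<phi> = K})"
  have fin: "finite (S \<upsilon> K)" for \<upsilon> :: "'a multiset" and K
    unfolding S_def by (rule finite_subset[OF _ finite_submsets[of \<upsilon>]]) auto
  have IH: "sum (W \<upsilon>) (S \<upsilon> K) = size \<upsilon> choose K" for K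
    using add by (simp add: W_def S_def)
  define R where "R = (\<lambda>\<phi> :: 'a multiset. \<Prod>x\<in>set_mset \<upsilon> - {a}. count \<upsilon> x choose count \<phi> x)"
  have W1: "W (add_mset a \<upsilon>) \<phi> = (Suc (count \<upsilon> a) choose count \<phi> a) * R \<phi>" for \<phi>
  proof -
    have "W (add_mset a \<upsilon>) \<phi> = (Suc (count \<upsilon> a) choose count \<phi> a) *
        (\<Prod>x\<in>set_mset \<upsilon> - {a}. count (add_mset a \<upsilon>) x choose count \<phi> x)"
      unfolding W_def by (simp add: prod.insert_remove)
    also have "(\<Prod>x\<in>set_mset \<upsilon> - {a}. count (add_mset a \<upsilon>) x choose count \<phi> x) = R \<phi>"
      unfolding R_def by (intro prod.cong) auto
    finally show ?thesis .
  qed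
  have W0: "W \<upsilon> \<phi> = (count \<upsilon> a choose count \<phi> a) * R \<phi>" if "\<phi> \<subseteq># \<upsilon>" for \<phi>
  proof (cases "a \<in># \<upsilon>")
    case True
    then show ?thesis unfolding W_def R_def by (simp add: prod.remove)
  next
    case False
    then have "count \<upsilon> a = 0" "count \<phi> a = 0"
      using that by (auto simp: not_in_iff dest: mset_subset_eq_count[of _ _ a])
    then show ?thesis using False by (simp add: W_def R_def)
  qed
  have z: "(count \<upsilon> a choose count \<phi> a) = 0"
    if s: "\<phi> \<subseteq># add_mset a \<upsilon>" and ns: "\<not> \<phi> \<subseteq># \<upsilon>" for \<phi>
  proof -
    obtain x where x: "count \<phi> x > count \<upsilon> x" using ns by (meson mset_subset_eqI not_le)
    moreover have "count \<phi> x \<le> count (add_mset a \<upsilon>) x" using s by (rule mset_subset_eq_count)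
    ultimately have "x = a" by (auto split: if_splits)
    with x show ?thesis by simp
  qed
  have sub: "S \<upsilon> K \<subseteq> S (add_mset a \<upsilon>) K" for K
    unfolding S_def using subset_mset.order_trans by fastforce
  have A: "(\<Sum>\<phi>\<in>S (add_mset a \<upsilon>) K. (count \<upsilon> a choose count \<phi> a) * R \<phi>) = size \<upsilon> choose K" for K
  proof -
    have "(\<Sum>\<phi>\<in>S (add_mset a \<upsilon>) K. (count \<upsilon> a choose count \<phi> a) * R \<phi>)
        = (\<Sum>\<phi>\<in>S \<upsilon> K. (count \<upsilon> a choose count \<phi> a) * R \<phi>)"
    proof (rule sum.mono_neutral_right[OF fin sub], intro ballI)
      fix \<phi> assume "\<phi> \<in> S (add_mset a \<upsilon>) K - S \<upsilon> K"
      then have "(count \<upsilon> a choose count \<phi> a) = 0" by (intro z) (auto simp: S_def)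
      then show "(count \<upsilon> a choose count \<phi> a) * R \<phi> = 0" by simp
    qed
    also have "\<dots> = sum (W \<upsilon>) (S \<upsilon> K)" by (intro sum.cong) (auto simp: S_def W0)
    finally show ?thesis by (simp add: IH)
  qed
  have "sum (W (add_mset a \<upsilon>)) (S (add_mset a \<upsilon>) K) = Suc (size \<upsilon>) choose K"
  proof (cases K)
    case 0
    have "S (add_mset a \<upsilon>) K = {{#}}" using 0 by (auto simp: S_def)
    then show ?thesis using 0 by (simp add: W_def)
  next
    case (Suc k)
    have p: "W (add_mset a \<upsilon>) \<phi> = (count \<upsilon> a choose count \<phi> a) * R \<phi>
        + (if a \<in># \<phi> then (count \<upsilon> a choose (count \<phi> a - 1)) * R \<phi> else 0)" for \<phi>
    proof (cases "count \<phi> a")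
      case 0
      then have "a \<notin># \<phi>" by (metis not_in_iff)
      then show ?thesis using 0 by (simp add: W1)
    next
      case (Suc m)
      then have "a \<in># \<phi>" by (metis not_in_iff nat.distinct(1))
      then show ?thesis using Suc by (simp add: W1 algebra_simps)
    qed
    have bij: "{\<phi> \<in> S (add_mset a \<upsilon>) K. a \<in># \<phi>} = add_mset a ` S \<upsilon> k"
    proof (intro equalityI subsetI)
      fix \<phi> assume \<phi>: "\<phi> \<in> {\<phi> \<in> S (add_mset a \<upsilon>) K. a \<in># \<phi>}"
      then obtain \<psi> where "\<phi> = add_mset a \<psi>" by (metis (mono_tags, lifting) mem_Collect_eq mset_add)
      with \<phi> Suc show "\<phi> \<in> add_mset a ` S \<upsilon> k" by (auto simp: S_def)
    qed (use Suc in \<open>auto simp: S_def\<close>)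
    have R_add: "R (add_mset a \<psi>) = R \<psi>" for \<psi>
      unfolding R_def by (intro prod.cong) auto
    have "(\<Sum>\<phi>\<in>S (add_mset a \<upsilon>) K. if a \<in># \<phi> then (count \<upsilon> a choose (count \<phi> a - 1)) * R \<phi> else 0)
        = (\<Sum>\<phi>\<in>add_mset a ` S \<upsilon> k. (count \<upsilon> a choose (count \<phi> a - 1)) * R \<phi>)"
      unfolding bij[symmetric] by (rule sum.inter_filter[symmetric, OF fin])
    also have "\<dots> = (\<Sum>\<psi>\<in>S \<upsilon> k. (count \<upsilon> a choose count \<psi> a) * R \<psi>)"
      by (subst sum.reindex) (auto simp: inj_on_def R_add)
    also have "\<dots> = sum (W \<upsilon>) (S \<upsilon> k)" by (intro sum.cong) (auto simp: S_def W0)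
    finally have B: "(\<Sum>\<phi>\<in>S (add_mset a \<upsilon>) K.
        if a \<in># \<phi> then (count \<upsilon> a choose (count \<phi> a - 1)) * R \<phi> else 0) = size \<upsilon> choose k"
      by (simp add: IH)
    show ?thesis unfolding p sum.distrib A B using Suc by simp
  qed
  then show ?case by (simp add: W_def S_def)
qed

lemma pmf_hg:
  assumes "K \<le> size \<upsilon>"
  shows "pmf (hg K \<upsilon>) \<phi> = hg_weight K \<upsilon> \<phi>"
proof -
  let ?S = "{\<phi>. \<phi> \<subseteq># \<upsilon> \<and> size \<phi> = K}"
  have fin: "finite ?S" by (rule finite_subset[OF _ finite_submsets[of \<upsilon>]]) auto
  have nn: "hg_weight K \<upsilon> \<psi> \<ge> 0" for \<psi> by (simp add: hg_weight_def prod_nonneg)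
  have "(\<Sum>\<phi>\<in>?S. hg_weight K \<upsilon> \<phi>) =
      (\<Sum>\<phi>\<in>?S. real (\<Prod>x\<in>set_mset \<upsilon>. count \<upsilon> x choose count \<phi> x)) / real (size \<upsilon> choose K)"
    unfolding sum_divide_distrib by (intro sum.cong) (auto simp: hg_weight_def)
  also have "\<dots> = 1" using assms
    by (simp only: of_nat_sum[symmetric] vandermonde_mset) simp
  finally have sum1: "(\<Sum>\<phi>\<in>?S. hg_weight K \<upsilon> \<phi>) = 1" .
  have "(\<integral>\<^sup>+ \<psi>. ennreal (hg_weight K \<upsilon> \<psi>) \<partial>count_space UNIV) =
      (\<Sum>\<psi>\<in>?S. ennreal (hg_weight K \<upsilon> \<psi>))"
    by (rule nn_integral_count_space'[OF fin]) (auto simp: hg_weight_def)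
  also have "\<dots> = 1" using nn sum1 by (simp add: sum_ennreal)
  finally show ?thesis unfolding hg_def using nn by (intro pmf_embed_pmf)
qed

end

theory Submission
  imports Defs
begin

text \<open>
  Let \<open>\<tau>\<close> be an optimal integral coupling of \<open>\<upsilon>\<close> and \<open>\<upsilon>'\<close>. Drawing \<open>K\<close> pairs from \<open>\<tau>\<close> without replacement and
  taking marginals couples \<open>hg K \<upsilon>\<close> with \<open>hg K \<upsilon>'\<close>; since the hypergeometric mean is \<open>K/L\<close> times the
  urn, this coupling costs at most the distance of the urns. Conversely, optimality of \<open>\<tau>\<close> makes its support
  cyclically monotone, which yields a 1-Lipschitz function \<open>f\<close> with \<open>f x - f y = d x y\<close> for all
  \<open>(x, y)\<close> in \<open>\<tau>\<close>. Integrating \<open>f\<close> against any, possibly fractional, coupling of \<open>hg K \<upsilon>\<close> and \<open>hg K \<upsilon>'\<close>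
  bounds its cost from below by the cost of \<open>\<tau>\<close>.
\<close>

section \<open>Optimal couplings of multisets\<close>

text \<open>Carrier and size are determined by the marginals, which makes this a finite set
  (\<open>finite_couplings\<close>).\<close>

definition couplings :: "'a multiset \<Rightarrow> 'b multiset \<Rightarrow> ('a \<times> 'b) multiset set" where
  "couplings \<phi> \<phi>' = {\<tau>. image_mset fst \<tau> = \<phi> \<and> image_mset snd \<tau> = \<phi>'}"

text \<open>Left unnormalised and summed with multiplicity, so that it is additive in \<tau> and
  exchanging a few pairs changes only their terms.\<close>

definition transport_cost :: "('a \<Rightarrow> 'b \<Rightarrow> real) \<Rightarrow> ('a \<times> 'b) multiset \<Rightarrow> real" where
  "transport_cost d \<tau> = (\<Sum>p\<in>#\<tau>. d (fst p) (snd p))"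

lemma sum_mset_eq_sum_count:
  fixes g :: "'a \<Rightarrow> real"
  shows "(\<Sum>x\<in>#A. g x) = (\<Sum>x\<in>set_mset A. real (count A x) * g x)"
proof (induction A)
  case (add a A)
  have "(\<Sum>x\<in>insert a (set_mset A). real (count (add_mset a A) x) * g x)
      = (\<Sum>x\<in>insert a (set_mset A). real (count A x) * g x + (if x = a then g a else 0))"
    by (intro sum.cong) (auto simp: algebra_simps)
  also have "\<dots> = (\<Sum>x\<in>insert a (set_mset A). real (count A x) * g x) + g a"
    by (simp add: sum.distrib)
  also have "(\<Sum>x\<in>insert a (set_mset A). real (count A x) * g x)
      = (\<Sum>x\<in>set_mset A. real (count A x) * g x)"
    by (rule sum.mono_neutral_right) (auto simp: not_in_iff)
  finally show ?case using add by simp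
qed simp

lemma sum_mset_subtractf:
  fixes f g :: "'a \<Rightarrow> real"
  shows "(\<Sum>x\<in>#A. f x - g x) = (\<Sum>x\<in>#A. f x) - (\<Sum>x\<in>#A. g x)"
  by (induction A) auto

lemma finite_multisets_of_size:
  assumes "finite A"
  shows "finite (multisets_of_size A n)"
proof -
  have "multisets_of_size A n \<subseteq> mset ` {xs. set xs \<subseteq> A \<and> length xs = n}"
  proof
    fix \<phi> assume "\<phi> \<in> multisets_of_size A n"
    then show "\<phi> \<in> mset ` {xs. set xs \<subseteq> A \<and> length xs = n}"
      by (metis (mono_tags, lifting) ex_mset image_eqI mem_Collect_eq multisets_of_size_def
          set_mset_mset size_mset)
  qed
  then show ?thesis using finite_lists_length_eq[OF assms, of n] finite_surj by blast
qed

lemma couplings_in_multisets_of_size: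
  assumes "\<phi> \<in> multisets_of_size X K" "\<phi>' \<in> multisets_of_size Y K" "\<tau> \<in> couplings \<phi> \<phi>'"
  shows "\<tau> \<in> multisets_of_size (X \<times> Y) K"
  using assms by (fastforce simp: couplings_def multisets_of_size_def)

lemma finite_couplings: "finite (couplings \<phi> \<phi>')"
proof -
  have "couplings \<phi> \<phi>' \<subseteq> multisets_of_size (set_mset \<phi> \<times> set_mset \<phi>') (size \<phi>)"
    by (force simp: couplings_def multisets_of_size_def)
  then show ?thesis by (rule finite_subset) (simp add: finite_multisets_of_size)
qed

text \<open>List both multisets in any order and pair them position by position.\<close>

lemma couplings_nonempty:
  assumes "size \<phi> = size \<phi>'"
  shows "couplings \<phi> \<phi>' \<noteq> {}"
proof -
  obtain xs ys where "\<phi> = mset xs" "\<phi>' = mset ys" by (metis ex_mset)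
  then have "mset (zip xs ys) \<in> couplings \<phi> \<phi>'"
    using assms by (simp add: couplings_def flip: mset_map)
  then show ?thesis by blast
qed

text \<open>Couplings form a finite nonempty set, so a cheapest one exists and the
  \<open>LEAST\<close> in \<open>kantorovich_mset\<close> is a genuine minimum.\<close>

lemma optimal_coupling:
  assumes "\<phi> \<in> multisets_of_size X K" "\<phi>' \<in> multisets_of_size X K"
  obtains \<tau> where "\<tau> \<in> couplings \<phi> \<phi>'"
    "kantorovich_mset K X d \<phi> \<phi>' = transport_cost d \<tau> / real K"
    "\<And>\<tau>'. \<tau>' \<in> couplings \<phi> \<phi>' \<Longrightarrow> transport_cost d \<tau> \<le> transport_cost d \<tau>'"
proof -
  have "couplings \<phi> \<phi>' \<noteq> {}"
    using assms by (intro couplings_nonempty) (simp add: multisets_of_size_def)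
  then obtain \<tau> where \<tau>: "\<tau> \<in> couplings \<phi> \<phi>'"
    and min: "\<And>\<tau>'. \<tau>' \<in> couplings \<phi> \<phi>' \<Longrightarrow> transport_cost d \<tau> \<le> transport_cost d \<tau>'"
    using ex_min_if_finite[of "transport_cost d ` couplings \<phi> \<phi>'"] finite_couplings
    by (metis (no_types, lifting) arg_min_if_finite(1) arg_min_least)
  have cost: "1 / real K * (\<Sum>(x, x')\<in>set_mset \<rho>. real (count \<rho> (x, x')) * d x x')
      = transport_cost d \<rho> / real K" for \<rho>
    by (simp add: transport_cost_def sum_mset_eq_sum_count case_prod_unfold)
  have "kantorovich_mset K X d \<phi> \<phi>' = transport_cost d \<tau> / real K"
    unfolding kantorovich_mset_def cost
  proof (rule Least_equality)
    show "\<exists>\<rho>\<in>multisets_of_size (X \<times> X) K. image_mset fst \<rho> = \<phi> \<and> image_mset snd \<rho> = \<phi>' \<and>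
        transport_cost d \<tau> / real K = transport_cost d \<rho> / real K"
      using \<tau> couplings_in_multisets_of_size[OF assms \<tau>] by (auto simp: couplings_def)
  qed (auto simp: couplings_def intro!: divide_right_mono min)
  with \<tau> min that show ?thesis by blast
qed

lemma kantorovich_mset_le:
  assumes "\<phi> \<in> multisets_of_size X K" "\<phi>' \<in> multisets_of_size X K" "\<tau> \<in> couplings \<phi> \<phi>'"
  shows "kantorovich_mset K X d \<phi> \<phi>' \<le> transport_cost d \<tau> / real K"
  using optimal_coupling[OF assms(1,2)] assms(3) by (metis divide_right_mono of_nat_0_le_iff)

text \<open>The easy half of Kantorovich duality: sum the Lipschitz bound over the pairs of an
  optimal coupling; the left side depends on the marginals only.\<close>

lemma lipschitz_le_kantorovich_mset:
  fixes f :: "'a \<Rightarrow> real"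
  assumes "\<phi> \<in> multisets_of_size X K" "\<phi>' \<in> multisets_of_size X K" "0 < K"
    and lip: "\<And>x y. x \<in> X \<Longrightarrow> y \<in> X \<Longrightarrow> f x - f y \<le> d x y"
  shows "((\<Sum>x\<in>#\<phi>. f x) - (\<Sum>x\<in>#\<phi>'. f x)) / real K \<le> kantorovich_mset K X d \<phi> \<phi>'"
proof -
  obtain \<tau> where \<tau>: "\<tau> \<in> couplings \<phi> \<phi>'"
    and eq: "kantorovich_mset K X d \<phi> \<phi>' = transport_cost d \<tau> / real K"
    using optimal_coupling[OF assms(1,2)] by metis
  have X: "set_mset \<tau> \<subseteq> X \<times> X"
    using couplings_in_multisets_of_size[OF assms(1,2) \<tau>] by (simp add: multisets_of_size_def)
  have "(\<Sum>x\<in>#\<phi>. f x) - (\<Sum>x\<in>#\<phi>'. f x) = (\<Sum>p\<in>#\<tau>. f (fst p) - f (snd p))"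
    using \<tau> by (auto simp: couplings_def sum_mset_subtractf multiset.map_comp comp_def)
  also have "\<dots> \<le> transport_cost d \<tau>"
    unfolding transport_cost_def using X by (intro sum_mset_mono lip) auto
  finally show ?thesis unfolding eq by (intro divide_right_mono) auto
qed

section \<open>Kantorovich potentials\<close>

fun path_weight :: "('v \<Rightarrow> 'v \<Rightarrow> real) \<Rightarrow> 'v list \<Rightarrow> real" where
  "path_weight w (x # y # zs) = w x y + path_weight w (y # zs)"
| "path_weight w _ = 0"

lemma path_weight_append:
  "path_weight w (xs @ y # ys) = path_weight w (xs @ [y]) + path_weight w (y # ys)"
  by (induction w xs rule: path_weight.induct) (auto simp: neq_Nil_conv)

text \<open>For \<open>y = x\<close> the second list is \<open>rotate1 (x # xs)\<close>, so closed
  paths have the cyclic sums of \<open>exists_potential\<close> as weights.\<close>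

lemma path_weight_snoc: "path_weight w (x # xs @ [y]) = sum_list (map2 w (x # xs) (xs @ [y]))"
  by (induction xs arbitrary: x) auto

text \<open>
  The potential is the length of a shortest simple path starting at \<open>p\<close>; a path that would run through \<open>p\<close> again
  is shortened by cutting off a cycle.
\<close>

lemma exists_potential:
  fixes w :: "'v \<Rightarrow> 'v \<Rightarrow> real"
  assumes "finite V"
    and cyc: "\<And>xs. xs \<noteq> [] \<Longrightarrow> distinct xs \<Longrightarrow> set xs \<subseteq> V \<Longrightarrow>
      0 \<le> sum_list (map2 w xs (rotate1 xs))"
  obtains v where "\<And>p q. p \<in> V \<Longrightarrow> q \<in> V \<Longrightarrow> v p \<le> w p q + v q"
proof -
  define P where "P = (\<lambda>p. {xs. xs \<noteq> [] \<and> hd xs = p \<and> set xs \<subseteq> V \<and> distinct xs})"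
  define v where "v = (\<lambda>p. Min (path_weight w ` P p))"
  have fin: "finite (P p)" for p
    by (rule finite_subset[OF _ finite_subset_distinct[OF assms(1)]]) (auto simp: P_def)
  have v_le: "v p \<le> path_weight w xs" if "xs \<in> P p" for p xs
    unfolding v_def using fin that by (intro Min_le) auto
  have "v p \<le> w p q + v q" if pq: "p \<in> V" "q \<in> V" for p q
  proof -
    \<comment> \<open>The one-vertex path makes \<open>P q\<close> nonempty, so the minimum
      \<open>v q\<close> is attained.\<close>
    have "[q] \<in> P q" using pq by (simp add: P_def)
    then have "v q \<in> path_weight w ` P q" unfolding v_def using fin by (intro Min_in) auto
    then obtain xs where xs: "xs \<in> P q" "v q = path_weight w xs" by auto
    have w: "w p q + v q = path_weight w (p # xs)"
      using xs by (cases xs) (auto simp: P_def)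
    show ?thesis
    proof (cases "p \<in> set xs")
      case False
      then have "p # xs \<in> P p" using xs pq by (auto simp: P_def)
      then show ?thesis unfolding w by (rule v_le)
    next
      case True
      then obtain as bs where s: "xs = as @ p # bs" by (meson split_list)
      have "path_weight w (p # xs) = path_weight w (p # as @ [p]) + path_weight w (p # bs)"
        unfolding s using path_weight_append[of w "p # as" p bs] by simp
      \<comment> \<open>Since \<open>xs\<close> is distinct, \<open>p\<close> does not occur in
        \<open>as\<close>; thus \<open>p # as\<close> is a simple cycle and \<open>cyc\<close>
        applies.\<close>
      moreover have "0 \<le> path_weight w (p # as @ [p])"
        using cyc[of "p # as"] xs pq by (simp add: path_weight_snoc P_def s)
      moreover have "v p \<le> path_weight w (p # bs)"
        using xs pq by (intro v_le) (auto simp: P_def s)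
      ultimately show ?thesis using w by simp
    qed
  qed
  then show ?thesis by (rule that)
qed

text \<open>The sum is the change in cost when each source in \<open>ps\<close> is sent to the
  target of the next pair. This preserves both marginals, so optimality forbids a gain.\<close>

lemma optimal_coupling_cyclically_monotone:
  assumes opt: "\<And>\<tau>'. \<tau>' \<in> couplings (image_mset fst \<tau>) (image_mset snd \<tau>) \<Longrightarrow>
      transport_cost d \<tau> \<le> transport_cost d \<tau>'"
    and ps: "distinct ps" "set ps \<subseteq> set_mset \<tau>"
  shows "0 \<le> sum_list (map2 (\<lambda>p q. d (fst p) (snd q) - d (fst p) (snd p)) ps (rotate1 ps))"
proof -
  define qs where "qs = map2 (\<lambda>p q. (fst p, snd q)) ps (rotate1 ps)"
  \<comment> \<open>Distinctness matters: each pair of \<open>ps\<close> is used once, and \<tau>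
    contains it at least once.\<close>
  have "mset ps \<subseteq># \<tau>"
    using ps by (metis finite_set_mset mset_set_set mset_set_set_mset_msubset
        subset_imp_msubset_mset_set subset_mset.order_trans)
  then obtain \<rho> where \<tau>: "\<tau> = \<rho> + mset ps" by (metis subset_mset.diff_add)
  have "map fst qs = map fst ps" "map snd qs = rotate1 (map snd ps)"
    by (auto simp: qs_def rotate1_map intro!: nth_equalityI)
  moreover have "mset (rotate1 xs) = mset xs" for xs :: "'b list" by (cases xs) auto
  ultimately have "\<rho> + mset qs \<in> couplings (image_mset fst \<tau>) (image_mset snd \<tau>)"
    by (simp add: couplings_def \<tau> flip: mset_map)
  then have "transport_cost d \<tau> \<le> transport_cost d (\<rho> + mset qs)" by (rule opt)
  then have "sum_list (map (\<lambda>p. d (fst p) (snd p)) ps) \<le> sum_list (map (\<lambda>p. d (fst p) (snd p)) qs)"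
    by (simp add: transport_cost_def \<tau> sum_mset_sum_list flip: mset_map)
  \<comment> \<open>Generalised from \<open>rotate1 ps\<close> to any list of equal length, because
    the rotation does not follow the list recursion.\<close>
  moreover have "sum_list (map2 (\<lambda>p q. d (fst p) (snd q) - d (fst p) (snd p)) xs ys)
      = sum_list (map (\<lambda>p. d (fst p) (snd p)) (map2 (\<lambda>p q. (fst p, snd q)) xs ys))
        - sum_list (map (\<lambda>p. d (fst p) (snd p)) xs)"
    if "length xs = length ys" for xs ys :: "('a \<times> 'b) list"
    using that by (induction xs ys rule: list_induct2) auto
  ultimately show ?thesis by (simp add: qs_def)
qed

text \<open>The hard half of duality. Together the two bounds give equality on the support of \<tau>
  (complementary slackness).\<close>

lemma kantorovich_potential:
  assumes "Metric_space X d" and X: "set_mset \<tau> \<subseteq> X \<times> X"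
    and opt: "\<And>\<tau>'. \<tau>' \<in> couplings (image_mset fst \<tau>) (image_mset snd \<tau>) \<Longrightarrow>
      transport_cost d \<tau> \<le> transport_cost d \<tau>'"
  obtains f :: "'a \<Rightarrow> real" where "\<And>x y. x \<in> X \<Longrightarrow> y \<in> X \<Longrightarrow> f x - f y \<le> d x y"
    "\<And>p. p \<in># \<tau> \<Longrightarrow> d (fst p) (snd p) \<le> f (fst p) - f (snd p)"
proof (cases "\<tau> = {#}")
  \<comment> \<open>\<open>Min\<close> of the empty set is unspecified, so an empty \<tau> is
    treated apart.\<close>
  case True
  with that[of "\<lambda>_. 0"] Metric_space.nonneg[OF assms(1)] show ?thesis by simp
next
  case False
  interpret Metric_space X d by fact
  \<comment> \<open>The vertices are the pairs in \<tau>; the edge from \<open>p\<close> to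
    \<open>q\<close> weighs the extra cost of rerouting the source of \<open>p\<close> to the target
    of \<open>q\<close>. Cyclic monotonicity excludes negative cycles.\<close>
  obtain v where v: "\<And>p q. p \<in># \<tau> \<Longrightarrow> q \<in># \<tau> \<Longrightarrow>
      v p \<le> d (fst p) (snd q) - d (fst p) (snd p) + v q"
    using exists_potential[OF finite_set_mset[of \<tau>]
        optimal_coupling_cyclically_monotone[where d = d, OF opt]] by blast
  \<comment> \<open>a minimum of translated distances is 1-Lipschitz, whatever \<open>v\<close> is\<close>
  define f where "f = (\<lambda>z. Min ((\<lambda>q. v q + d z (snd q)) ` set_mset \<tau>))"
  have f_le: "f z \<le> v q + d z (snd q)" if "q \<in># \<tau>" for z q
    unfolding f_def using that by (intro Min_le) auto
  have f_ge: "c \<le> f z" if "\<And>q. q \<in># \<tau> \<Longrightarrow> c \<le> v q + d z (snd q)" for c z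
    unfolding f_def using that False by (intro Min.boundedI) auto
  have 1: "f x - f y \<le> d x y" if "x \<in> X" "y \<in> X" for x y
  proof -
    have "f x - d x y \<le> f y"
    proof (rule f_ge)
      fix q assume q: "q \<in># \<tau>"
      then have "d x (snd q) \<le> d x y + d y (snd q)" using X that by (intro triangle) auto
      with f_le[OF q, of x] show "f x - d x y \<le> v q + d y (snd q)" by linarith
    qed
    then show ?thesis by simp
  qed
  have 2: "d (fst p) (snd p) \<le> f (fst p) - f (snd p)" if p: "p \<in># \<tau>" for p
  proof -
    have "snd p \<in> X" using X p by auto
    \<comment> \<open>Choose \<open>q = p\<close> in the minimum: the distance from
      \<open>snd p\<close> to itself vanishes.\<close>
    then have "f (snd p) \<le> v p" using f_le[OF p, of "snd p"] by simp
    moreover have "v p + d (fst p) (snd p) \<le> f (fst p)"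
      using v[OF p] by (intro f_ge) (simp add: algebra_simps)
    ultimately show ?thesis by simp
  qed
  from 1 2 show ?thesis by (rule that)
qed

section \<open>The hypergeometric distribution as sampling of subsets\<close>

lemma count_image_mset_set:
  assumes "finite S"
  shows "count (image_mset f (mset_set S)) x = card {a \<in> S. f a = x}"
  using assms by (simp add: count_image_mset' Collect_conj_eq eq_commute[of x])

text \<open>Such a subset amounts to an independent choice of \<open>count \<phi> x\<close> elements
  in the fibre of \<open>f\<close> over each \<open>x\<close>, hence a product of binomials.\<close>

lemma card_subsets_image_mset_eq:
  assumes "finite A"
  shows "card {S. S \<subseteq> A \<and> image_mset f (mset_set S) = \<phi>} =
    (if set_mset \<phi> \<subseteq> f ` A then \<Prod>x\<in>f ` A. card {a \<in> A. f a = x} choose count \<phi> x else 0)"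
proof (cases "set_mset \<phi> \<subseteq> f ` A")
  case False
  have "{S. S \<subseteq> A \<and> image_mset f (mset_set S) = \<phi>} = {}"
    using False assms finite_subset[OF _ assms] by fastforce
  then have "card {S. S \<subseteq> A \<and> image_mset f (mset_set S) = \<phi>} = 0" by (simp only: card.empty)
  with False show ?thesis by simp
next
  case True
  define F where "F = (\<lambda>x. {a \<in> A. f a = x})"
  define Q where "Q = (\<lambda>x. {T. T \<subseteq> F x \<and> card T = count \<phi> x})"
  \<comment> \<open>\<open>h\<close> cuts a subset into its fibres; taking unions is the inverse.
    The restriction makes \<open>h S\<close> extensional, as \<open>Pi\<^sub>E\<close>
    demands.\<close>
  define h where "h = (\<lambda>S. \<lambda>x\<in>f ` A. {a \<in> S. f a = x})"
  have cnt: "count (image_mset f (mset_set S)) x = card {a \<in> S. f a = x}" if "S \<subseteq> A" for S x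
    by (rule count_image_mset_set[OF finite_subset[OF that assms]])
  have eq_iff: "image_mset f (mset_set S) = \<phi> \<longleftrightarrow> (\<forall>x\<in>f ` A. card {a \<in> S. f a = x} = count \<phi> x)"
    if S: "S \<subseteq> A" for S
  proof -
    have "card {a \<in> S. f a = x} = count \<phi> x" if "x \<notin> f ` A" for x
    proof -
      have "{a \<in> S. f a = x} = {}" "x \<notin># \<phi>" using that S True by auto
      then show ?thesis by (metis card.empty not_in_iff)
    qed
    then show ?thesis unfolding multiset_eq_iff cnt[OF S] by blast
  qed
  have "bij_betw h {S. S \<subseteq> A \<and> image_mset f (mset_set S) = \<phi>} (Pi\<^sub>E (f ` A) Q)"
  proof (rule bij_betwI[where g = "\<lambda>T. \<Union>x\<in>f ` A. T x"])
    show "h \<in> {S. S \<subseteq> A \<and> image_mset f (mset_set S) = \<phi>} \<rightarrow> Pi\<^sub>E (f ` A) Q"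
      by (auto simp: h_def Q_def F_def cnt)
    have fib: "{a \<in> (\<Union>y\<in>f ` A. T y). f a = x} = T x" if "T \<in> Pi\<^sub>E (f ` A) Q" "x \<in> f ` A" for T x
    proof -
      have "T y \<subseteq> F y" if "y \<in> f ` A" for y
        using PiE_mem[OF \<open>T \<in> _\<close> that] by (simp add: Q_def)
      then show ?thesis using \<open>x \<in> f ` A\<close> by (fastforce simp: F_def)
    qed
    have sub: "(\<Union>y\<in>f ` A. T y) \<subseteq> A" if "T \<in> Pi\<^sub>E (f ` A) Q" for T
      using PiE_mem[OF that] by (fastforce simp: Q_def F_def)
    show "(\<lambda>T. \<Union>x\<in>f ` A. T x) \<in> Pi\<^sub>E (f ` A) Q \<rightarrow> {S. S \<subseteq> A \<and> image_mset f (mset_set S) = \<phi>}"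
    proof
      fix T assume T: "T \<in> Pi\<^sub>E (f ` A) Q"
      have "card (T x) = count \<phi> x" if "x \<in> f ` A" for x
        using PiE_mem[OF T that] by (simp add: Q_def)
      then show "(\<Union>x\<in>f ` A. T x) \<in> {S. S \<subseteq> A \<and> image_mset f (mset_set S) = \<phi>}"
        using sub[OF T] eq_iff[OF sub[OF T]] fib[OF T] by (metis (mono_tags, lifting) mem_Collect_eq)
    qed
    show "(\<Union>x\<in>f ` A. h S x) = S" if "S \<in> {S. S \<subseteq> A \<and> image_mset f (mset_set S) = \<phi>}" for S
      using that by (auto simp: h_def)
    show "h (\<Union>x\<in>f ` A. T x) = T" if T: "T \<in> Pi\<^sub>E (f ` A) Q" for T
    proof
      fix x show "h (\<Union>x\<in>f ` A. T x) x = T x"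
        using fib[OF T, of x] PiE_arb[OF T, of x] by (auto simp only: h_def restrict_def split: if_splits)
    qed
  qed
  then have "card {S. S \<subseteq> A \<and> image_mset f (mset_set S) = \<phi>} = card (Pi\<^sub>E (f ` A) Q)"
    by (rule bij_betw_same_card)
  also have "\<dots> = (\<Prod>x\<in>f ` A. card (Q x))" using assms by (intro card_PiE) auto
  also have "\<dots> = (\<Prod>x\<in>f ` A. card {a \<in> A. f a = x} choose count \<phi> x)"
    using assms by (intro prod.cong) (auto simp: Q_def F_def n_subsets)
  finally show ?thesis using True by simp
qed

lemma finite_card_subsets: "finite A \<Longrightarrow> finite {S. S \<subseteq> A \<and> card S = K}"
  by (rule finite_subset[of _ "Pow A"]) auto

lemma card_subsets_nonempty:
  assumes "K \<le> card A"
  shows "{S. S \<subseteq> A \<and> card S = K} \<noteq> {}"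
  using obtain_subset_with_card_n[OF assms] by blast

text \<open>\<open>A\<close> is an urn of labelled balls with colours given by \<open>f\<close>. The
  binomial formula becomes a uniform choice of balls, from which marginals and means are easily read
  off.\<close>

lemma hg_eq_subset_sampling:
  assumes A: "finite A" and K: "K \<le> card A"
  shows "hg K (image_mset f (mset_set A)) =
    map_pmf (\<lambda>S. image_mset f (mset_set S)) (pmf_of_set {S. S \<subseteq> A \<and> card S = K})"
proof (rule pmf_eqI)
  fix \<phi>
  define \<upsilon> where "\<upsilon> = image_mset f (mset_set A)"
  let ?P = "{S. S \<subseteq> A \<and> card S = K}"
  let ?E = "{S. S \<subseteq> A \<and> image_mset f (mset_set S) = \<phi>}"
  have cnt: "count \<upsilon> x = card {a \<in> A. f a = x}" for x
    using A by (simp add: \<upsilon>_def count_image_mset_set)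
  have "pmf (map_pmf (\<lambda>S. image_mset f (mset_set S)) (pmf_of_set ?P)) \<phi>
      = card (?P \<inter> (\<lambda>S. image_mset f (mset_set S)) -` {\<phi>}) / (card A choose K)"
    using finite_card_subsets[OF A] card_subsets_nonempty[OF K]
    by (simp add: pmf_map measure_pmf_of_set n_subsets[OF A])
  \<comment> \<open>A set with image \<phi> has \<open>size \<phi>\<close> elements, so the
    cardinality condition depends on \<phi> alone.\<close>
  also have "?P \<inter> (\<lambda>S. image_mset f (mset_set S)) -` {\<phi>} = (if size \<phi> = K then ?E else {})"
    by auto
  also have "card (if size \<phi> = K then ?E else {}) / (card A choose K) = hg_weight K \<upsilon> \<phi>"
  proof (cases "\<phi> \<subseteq># \<upsilon>")
    case True
    then have "set_mset \<phi> \<subseteq> f ` A" using A set_mset_mono[OF True] by (auto simp: \<upsilon>_def)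
    moreover have "set_mset \<upsilon> = f ` A" using A by (simp add: \<upsilon>_def)
    ultimately show ?thesis
      using True A by (simp add: hg_weight_def card_subsets_image_mset_eq cnt) (simp add: \<upsilon>_def)
  next
    case False
    have "image_mset f (mset_set S) \<subseteq># \<upsilon>" if "S \<subseteq> A" for S
      unfolding \<upsilon>_def by (intro image_mset_subseteq_mono subset_imp_msubset_mset_set that A)
    with False have "?E = {}" by auto
    with False show ?thesis by (simp only: hg_weight_def) simp
  qed
  also have "\<dots> = pmf (hg K \<upsilon>) \<phi>" using K A by (intro pmf_hg[symmetric]) (simp add: \<upsilon>_def)
  finally show "pmf (hg K (image_mset f (mset_set A))) \<phi> =
      pmf (map_pmf (\<lambda>S. image_mset f (mset_set S)) (pmf_of_set ?P)) \<phi>" by (simp add: \<upsilon>_def)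
qed

text \<open>Labelling by positions in a list makes equal elements distinguishable.\<close>

lemma multiset_as_image_mset_set:
  obtains f :: "nat \<Rightarrow> 'a" where "\<upsilon> = image_mset f (mset_set {..<size \<upsilon>})"
proof -
  obtain xs where "\<upsilon> = mset xs" by (metis ex_mset)
  then have "\<upsilon> = image_mset ((!) xs) (mset_set {..<size \<upsilon>})"
    by (metis map_nth mset_map mset_set_upto_eq_mset_upto size_mset)
  then show ?thesis by (rule that)
qed

text \<open>Recolouring commutes with drawing: both sides colour the same uniform subset by
  \<open>g \<circ> f\<close>. Taking \<open>fst\<close> and \<open>snd\<close> for \<open>g\<close>
  gives the marginals of a draw of pairs.\<close>

lemma hg_image_mset:
  assumes "K \<le> size \<upsilon>"
  shows "hg K (image_mset g \<upsilon>) = map_pmf (image_mset g) (hg K \<upsilon>)"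
proof -
  obtain f where f: "\<upsilon> = image_mset f (mset_set {..<size \<upsilon>})" by (rule multiset_as_image_mset_set)
  have "image_mset g \<upsilon> = image_mset (g \<circ> f) (mset_set {..<size \<upsilon>})"
    by (subst f) (simp add: multiset.map_comp)
  then show ?thesis
    using assms hg_eq_subset_sampling[of "{..<size \<upsilon>}" K f]
      hg_eq_subset_sampling[of "{..<size \<upsilon>}" K "g \<circ> f"] f
    by (simp add: map_pmf_comp multiset.map_comp)
qed

lemma card_subsets_containing:
  assumes "finite A" "a \<in> A" "0 < K"
  shows "card {S. S \<subseteq> A \<and> card S = K \<and> a \<in> S} = (card A - 1) choose (K - 1)"
proof -
  have "bij_betw (insert a) {S. S \<subseteq> A - {a} \<and> card S = K - 1} {S. S \<subseteq> A \<and> card S = K \<and> a \<in> S}"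
  proof (rule bij_betwI[where g = "\<lambda>S. S - {a}"])
    show "insert a \<in> {S. S \<subseteq> A - {a} \<and> card S = K - 1} \<rightarrow> {S. S \<subseteq> A \<and> card S = K \<and> a \<in> S}"
    proof
      fix S assume S: "S \<in> {S. S \<subseteq> A - {a} \<and> card S = K - 1}"
      then have "finite S" "a \<notin> S" using assms finite_subset[of S A] by auto
      with S assms show "insert a S \<in> {S. S \<subseteq> A \<and> card S = K \<and> a \<in> S}" by auto
    qed
  qed auto
  then have "card {S. S \<subseteq> A \<and> card S = K \<and> a \<in> S} = card {S. S \<subseteq> A - {a} \<and> card S = K - 1}"
    by (rule bij_betw_same_card[symmetric])
  with assms show ?thesis by (simp add: n_subsets)
qed

text \<open>Double counting: each ball lies in \<open>(n - 1) choose (K - 1)\<close> of the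
  \<open>n choose K\<close> subsets, which is a fraction \<open>K / n\<close> by the absorption
  identity.\<close>

lemma expectation_hg:
  fixes g :: "'a \<Rightarrow> real"
  assumes "0 < K" "K \<le> size \<upsilon>"
  shows "measure_pmf.expectation (hg K \<upsilon>) (\<lambda>\<phi>. \<Sum>x\<in>#\<phi>. g x) =
    real K / real (size \<upsilon>) * (\<Sum>x\<in>#\<upsilon>. g x)"
proof -
  define n where "n = size \<upsilon>"
  obtain f where f: "\<upsilon> = image_mset f (mset_set {..<n})"
    unfolding n_def by (rule multiset_as_image_mset_set)
  let ?P = "{S. S \<subseteq> {..<n} \<and> card S = K}"
  have Kn: "K \<le> n" using assms by (simp add: n_def)
  have P: "finite ?P" "?P \<noteq> {}"
    using Kn finite_card_subsets[of "{..<n}" K] card_subsets_nonempty[of K "{..<n}"] by auto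
  have "(\<Sum>S\<in>?P. \<Sum>i\<in>S. g (f i)) = (\<Sum>S\<in>?P. \<Sum>i | i \<in> {..<n} \<and> i \<in> S. g (f i))"
    by (intro sum.cong refl) auto
  also have "\<dots> = (\<Sum>i<n. \<Sum>S | S \<in> ?P \<and> i \<in> S. g (f i))"
    using P by (intro sum.swap_restrict) auto
  also have "\<dots> = (\<Sum>i<n. real ((n - 1) choose (K - 1)) * g (f i))"
  proof (intro sum.cong refl)
    fix i assume "i \<in> {..<n}"
    then have "card {S. S \<in> ?P \<and> i \<in> S} = (n - 1) choose (K - 1)"
      using card_subsets_containing[of "{..<n}" i K] assms by (simp add: conj_assoc)
    then show "(\<Sum>S | S \<in> ?P \<and> i \<in> S. g (f i)) = real ((n - 1) choose (K - 1)) * g (f i)"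
      by (simp only: sum_constant)
  qed
  also have "\<dots> = real ((n - 1) choose (K - 1)) * (\<Sum>x\<in>#\<upsilon>. g x)"
    by (simp add: f sum_unfold_sum_mset multiset.map_comp comp_def sum_mset_distrib_left)
  finally have total: "(\<Sum>S\<in>?P. \<Sum>i\<in>S. g (f i)) = \<dots>" .
  have "real K * real (n choose K) = real n * real ((n - 1) choose (K - 1))"
    using times_binomial_minus1_eq[OF assms(1), of n] by (metis of_nat_mult)
  then have ratio: "real ((n - 1) choose (K - 1)) / real (n choose K) = real K / real n"
    using assms Kn by (simp add: field_simps)
  have "measure_pmf.expectation (hg K \<upsilon>) (\<lambda>\<phi>. \<Sum>x\<in>#\<phi>. g x)
      = measure_pmf.expectation (pmf_of_set ?P) (\<lambda>S. \<Sum>i\<in>#mset_set S. g (f i))"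
    using Kn by (subst f) (simp add: hg_eq_subset_sampling multiset.map_comp comp_def)
  also have "\<dots> = (\<Sum>S\<in>?P. \<Sum>i\<in>S. g (f i)) / real (n choose K)"
    using P by (simp add: integral_pmf_of_set n_subsets flip: sum_unfold_sum_mset)
  also have "\<dots> = real ((n - 1) choose (K - 1)) / real (n choose K) * (\<Sum>x\<in>#\<upsilon>. g x)"
    by (simp add: total)
  also have "\<dots> = real K / real n * (\<Sum>x\<in>#\<upsilon>. g x)" by (simp only: ratio)
  finally show ?thesis by (simp add: n_def)
qed

lemma set_pmf_hg:
  assumes "K \<le> size \<upsilon>"
  shows "set_pmf (hg K \<upsilon>) \<subseteq> {\<phi>. \<phi> \<subseteq># \<upsilon> \<and> size \<phi> = K}"
  using pmf_hg[OF assms] by (auto simp: set_pmf_iff hg_weight_def split: if_splits)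

lemma hg_in_dists:
  assumes "\<upsilon> \<in> multisets_of_size X L" "K \<le> L"
  shows "hg K \<upsilon> \<in> dists (multisets_of_size X K)"
proof -
  have "K \<le> size \<upsilon>" using assms by (simp add: multisets_of_size_def)
  note s = set_pmf_hg[OF this]
  have "finite (set_pmf (hg K \<upsilon>))" 
    by (rule finite_subset[OF _ finite_submsets[of \<upsilon>]]) (use s in auto)
  moreover have "set_pmf (hg K \<upsilon>) \<subseteq> multisets_of_size X K"
  proof
    fix \<phi> assume "\<phi> \<in> set_pmf (hg K \<upsilon>)"
    then have "\<phi> \<subseteq># \<upsilon>" "size \<phi> = K" using s by auto
    then show "\<phi> \<in> multisets_of_size X K"
      using set_mset_mono[of \<phi> \<upsilon>] assms(1) by (auto simp: multisets_of_size_def)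
  qed
  ultimately show ?thesis by (simp add: dists_def)
qed

section \<open>The isometry\<close>

lemma kantorovich_dist_hg:
  fixes X :: "'a set" and d :: "'a \<Rightarrow> 'a \<Rightarrow> real"
  assumes "Metric_space X d" "0 < K" "K \<le> L"
    and \<upsilon>: "\<upsilon> \<in> multisets_of_size X L" "\<upsilon>' \<in> multisets_of_size X L"
  shows "kantorovich_dist (multisets_of_size X K) (kantorovich_mset K X d) (hg K \<upsilon>) (hg K \<upsilon>')
    = kantorovich_mset L X d \<upsilon> \<upsilon>'"
proof -
  let ?M = "multisets_of_size X K" and ?D = "kantorovich_mset K X d"
  define c where "c = kantorovich_mset L X d \<upsilon> \<upsilon>'"
  obtain \<tau> where \<tau>: "\<tau> \<in> couplings \<upsilon> \<upsilon>'" and c: "c = transport_cost d \<tau> / real L"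
    and opt: "\<And>\<tau>'. \<tau>' \<in> couplings \<upsilon> \<upsilon>' \<Longrightarrow> transport_cost d \<tau> \<le> transport_cost d \<tau>'"
    unfolding c_def using optimal_coupling[OF \<upsilon>] by metis
  have marg: "image_mset fst \<tau> = \<upsilon>" "image_mset snd \<tau> = \<upsilon>'" using \<tau> by (auto simp: couplings_def)
  have \<tau>_mem: "\<tau> \<in> multisets_of_size (X \<times> X) L"
    by (rule couplings_in_multisets_of_size[OF \<upsilon> \<tau>])
  then have \<tau>X: "set_mset \<tau> \<subseteq> X \<times> X" and \<tau>L: "size \<tau> = L" by (auto simp: multisets_of_size_def)
  have sz: "K \<le> size \<tau>" "K \<le> size \<upsilon>" "K \<le> size \<upsilon>'" "size \<upsilon> = L" "size \<upsilon>' = L"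
    using \<tau>L \<upsilon> assms(3) by (auto simp: multisets_of_size_def)
  have expect: "(\<Sum>(x, x')\<in>set_pmf \<sigma>. pmf \<sigma> (x, x') * ?D x x')
      = measure_pmf.expectation \<sigma> (\<lambda>p. ?D (fst p) (snd p))" if "\<sigma> \<in> dists (?M \<times> ?M)" for \<sigma>
    using that by (subst integral_measure_pmf[of "set_pmf \<sigma>"])
      (auto simp: dists_def case_prod_unfold)

  have lower: "c \<le> measure_pmf.expectation \<sigma> (\<lambda>p. ?D (fst p) (snd p))"
    if \<sigma>: "\<sigma> \<in> dists (?M \<times> ?M)" "map_pmf fst \<sigma> = hg K \<upsilon>" "map_pmf snd \<sigma> = hg K \<upsilon>'" for \<sigma>
  proof -
    obtain f :: "'a \<Rightarrow> real" where lip: "\<And>x y. x \<in> X \<Longrightarrow> y \<in> X \<Longrightarrow> f x - f y \<le> d x y"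
      and tight: "\<And>p. p \<in># \<tau> \<Longrightarrow> d (fst p) (snd p) \<le> f (fst p) - f (snd p)"
      using kantorovich_potential[OF assms(1) \<tau>X] opt unfolding marg by metis
    let ?F = "\<lambda>\<phi>. \<Sum>x\<in>#\<phi>. f x"
    have fin: "finite (set_pmf \<sigma>)" using \<sigma> by (simp add: dists_def)
    have int: "integrable (measure_pmf \<sigma>) h" for h :: "_ \<Rightarrow> real"
      using fin by (rule integrable_measure_pmf_finite)
    \<comment> \<open>These means involve only the marginals of \<sigma>, so its masses may be
      arbitrary reals.\<close>
    have mean: "measure_pmf.expectation \<sigma> (\<lambda>p. ?F (fst p)) = real K / real L * ?F \<upsilon>"
      "measure_pmf.expectation \<sigma> (\<lambda>p. ?F (snd p)) = real K / real L * ?F \<upsilon>'"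
      using expectation_hg[OF assms(2) sz(2), of f] expectation_hg[OF assms(2) sz(3), of f] sz
      by (simp_all flip: \<sigma>(2,3))
    have "transport_cost d \<tau> \<le> (\<Sum>p\<in>#\<tau>. f (fst p) - f (snd p))"
      unfolding transport_cost_def by (intro sum_mset_mono tight)
    also have "\<dots> = ?F \<upsilon> - ?F \<upsilon>'"
      by (simp add: sum_mset_subtractf multiset.map_comp comp_def flip: marg)
    finally have "c \<le> (?F \<upsilon> - ?F \<upsilon>') / real L" unfolding c by (intro divide_right_mono) auto
    \<comment> \<open>The factor \<open>K / L\<close> of the means, divided by \<open>K\<close>,
      leaves exactly the \<open>1 / L\<close> of the urn distance.\<close>
    also have "\<dots> = measure_pmf.expectation \<sigma> (\<lambda>p. (?F (fst p) - ?F (snd p)) / real K)"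
      using int assms(2) by (simp add: mean) (simp add: diff_divide_distrib)
    also have "\<dots> \<le> measure_pmf.expectation \<sigma> (\<lambda>p. ?D (fst p) (snd p))"
    proof (intro integral_mono_AE int AE_pmfI)
      fix p assume "p \<in> set_pmf \<sigma>"
      then have "fst p \<in> ?M" "snd p \<in> ?M" using \<sigma>(1) by (auto simp: dists_def)
      then show "(?F (fst p) - ?F (snd p)) / real K \<le> ?D (fst p) (snd p)"
        using assms(2) lip by (intro lipschitz_le_kantorovich_mset)
    qed
    finally show ?thesis .
  qed

  define \<sigma> where "\<sigma> = map_pmf (\<lambda>\<rho>. (image_mset fst \<rho>, image_mset snd \<rho>)) (hg K \<tau>)"
  have hg\<tau>: "finite (set_pmf (hg K \<tau>))" "set_pmf (hg K \<tau>) \<subseteq> multisets_of_size (X \<times> X) K"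
    using hg_in_dists[OF \<tau>_mem assms(3)] by (auto simp: dists_def)
  have img: "image_mset fst \<rho> \<in> ?M" "image_mset snd \<rho> \<in> ?M"
    if "\<rho> \<in> multisets_of_size (X \<times> X) K" for \<rho>
    using that by (auto simp: multisets_of_size_def)
  have \<sigma>: "\<sigma> \<in> dists (?M \<times> ?M)" using hg\<tau> img by (fastforce simp: dists_def \<sigma>_def)
  have \<sigma>_marg: "map_pmf fst \<sigma> = hg K \<upsilon>" "map_pmf snd \<sigma> = hg K \<upsilon>'"
    using hg_image_mset[OF sz(1), of fst] hg_image_mset[OF sz(1), of snd]
    by (auto simp: \<sigma>_def map_pmf_comp marg)
  have "measure_pmf.expectation \<sigma> (\<lambda>p. ?D (fst p) (snd p))
      = measure_pmf.expectation (hg K \<tau>) (\<lambda>\<rho>. ?D (image_mset fst \<rho>) (image_mset snd \<rho>))"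
    by (simp add: \<sigma>_def)
  \<comment> \<open>Each drawn \<rho> is itself a coupling of its two projections, so its cost
    bounds their distance.\<close>
  also have "\<dots> \<le> measure_pmf.expectation (hg K \<tau>) (\<lambda>\<rho>. transport_cost d \<rho> / real K)"
    using hg\<tau> img by (intro integral_mono_AE integrable_measure_pmf_finite AE_pmfI
        kantorovich_mset_le) (auto simp: couplings_def)
  also have "\<dots> = c"
    using expectation_hg[OF assms(2) sz(1), of "\<lambda>p. d (fst p) (snd p)"] assms(2) \<tau>L
    by (simp add: transport_cost_def c)
  finally have upper: "measure_pmf.expectation \<sigma> (\<lambda>p. ?D (fst p) (snd p)) \<le> c" .
  have "kantorovich_dist ?M ?D (hg K \<upsilon>) (hg K \<upsilon>') = c"
    unfolding kantorovich_dist_def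
  proof (rule Least_equality)
    show "\<exists>\<sigma>\<in>dists (?M \<times> ?M). map_pmf fst \<sigma> = hg K \<upsilon> \<and> map_pmf snd \<sigma> = hg K \<upsilon>' \<and>
        c = (\<Sum>(x, x')\<in>set_pmf \<sigma>. pmf \<sigma> (x, x') * ?D x x')"
      \<comment> \<open>The projected draw \<sigma> attains the minimum: \<open>upper\<close> and
        \<open>lower\<close> pin its cost to \<open>c\<close>.\<close>
      using \<sigma> \<sigma>_marg upper lower[OF \<sigma> \<sigma>_marg] expect[OF \<sigma>] by (intro bexI[of _ \<sigma>]) auto
  qed (auto simp: expect intro: lower)
  then show ?thesis by (simp add: c_def)
qed

theorem theorem8p2:
  fixes X :: "'a set" and d :: "'a \<Rightarrow> 'a \<Rightarrow> real" and K L :: nat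
  assumes "Metric_space X d"
    and "1 \<le> K" and "K \<le> L"
  shows "short_map (multisets_of_size X L) (kantorovich_mset L X d)
           (dists (multisets_of_size X K)) (kantorovich_dist (multisets_of_size X K) (kantorovich_mset K X d)) (hg K)
       \<and> isometry_map (multisets_of_size X L) (kantorovich_mset L X d)
           (dists (multisets_of_size X K)) (kantorovich_dist (multisets_of_size X K) (kantorovich_mset K X d)) (hg K)"
  using assms kantorovich_dist_hg[OF assms(1), of K L]
  by (auto simp: short_map_def isometry_map_def intro: hg_in_dists)

end
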